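(* In an episodic tabular MDP with one-step transition lookahead, the optimal value of one-step transition lookahead agents satisfies $$V^{T,*}_{H+1}(s)=0\quad\forall s\in\mathcal S,$$ $$V^{T,*}_h(s)=\mathbb E_{\boldsymbol s'\sim P_h(s)}\Big[\max_{a\in\mathcal A}\big\{r_h(s,a)+V^{T,*}_{h+1}(s'(a))\big\}\Big]\quad\forall s\in\mathcal S,\ h\in[H].$$ Moreover, given next-state observations $\boldsymbol s'=\{s'(a)\}_{a\in\mathcal A}$ at state $s$ and step $h$, the optimal policy is $$\pi^*_h(s,\boldsymbol s')\in\arg\max_{a\in\mathcal A}\big\{r_h(s,a)+V^{T,*}_{h+1}(s'(a))\big\}.$$
   Context: An episodic tabular MDP $\mathcal M=(\mathcal S,\mathcal A,H,P,\mathcal R)$ has finite state space $\mathcal S$, finite action space $\mathcal A$ ($|\mathcal A|=A$), horizon $H\in\mathbb N$ ($[H]=\{1,\dots,H\}$), for each $(h,s)$ a joint next-state distribution $P_h(s)$ on $\mathcal S^{\mathcal A}$ (coordinates for different actions may be dependent), and reward distributions $\mathcal R_h(s,a)$ on $[0,1]$ with means $r_h(s,a)$. One-step transition lookahead: at step $h$ in state $s_h$, the vector $\boldsymbol s'_{h+1}=\{s'_{h+1}(s_h,a)\}_{a\in\mathcal A}\sim P_h(s_h)$ of next states for all actions is drawn (independently of the past given $s_h$) and observed; the agent then picks $a_h$, receives a reward $R_h\sim\mathcal R_h(s_h,a_h)$ (drawn independently of everything else given $(s_h,a_h)$), and moves to $s_{h+1}=s'_{h+1}(s_h,a_h)$.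 Policies: $\Pi^T=\{\pi:[H]\times\mathcal S\times\mathcal S^{A}\to\Delta_{\mathcal A}\}$ ($\Delta_{\mathcal A}$ the probability simplex), with $a_h=\pi_h(s_h,\boldsymbol s'_{h+1})$. Value: $V_h^{T,\pi}(s)=\mathbb E[\sum_{t=h}^HR_t(s_t,\pi_t(s_t,\boldsymbol s'_{t+1}(s_t)))\mid s_h=s]$, and $V_h^{T,*}(s)=\max_{\pi\in\Pi^T}V_h^{T,\pi}(s)$. A policy is optimal if it attains $V_h^{T,*}(s)$ for all $h,s$. *)

theory Defs
  imports "HOL-Probability.Probability"
begin

text \<open>
  State and action spaces are finite types; steps are the naturals \<open>1..H\<close>. The distribution
  \<open>next_states M h s\<close> is a joint one on all of \<open>'a \<Rightarrow> 's\<close>, so the next states under different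
  actions may be dependent.
\<close>

record ('s, 'a) lookahead_mdp =
  horizon :: nat
  next_states :: "nat \<Rightarrow> 's \<Rightarrow> ('a \<Rightarrow> 's) pmf"
  reward :: "nat \<Rightarrow> 's \<Rightarrow> 'a \<Rightarrow> real measure"

definition valid_lookahead_mdp :: "('s::finite, 'a::finite) lookahead_mdp \<Rightarrow> bool" where
  "valid_lookahead_mdp M \<longleftrightarrow>
    (\<forall>h\<in>{1..horizon M}. \<forall>s a.
      prob_space (reward M h s a) \<and> sets (reward M h s a) = sets borel \<and>
      (AE x in reward M h s a. 0 \<le> x \<and> x \<le> 1))"

definition mean_reward :: "('s::finite, 'a::finite) lookahead_mdp \<Rightarrow> nat \<Rightarrow> 's \<Rightarrow> 'a \<Rightarrow> real" where
  "mean_reward M h s a = (\<integral>x. x \<partial>reward M h s a)"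

text \<open>Values of a policy at steps outside \<open>1..H\<close> never influence anything below.\<close>

type_synonym ('s, 'a) policy = "nat \<Rightarrow> 's \<Rightarrow> ('a \<Rightarrow> 's) \<Rightarrow> 'a pmf"

text \<open>
  Law of the list of triples (state, observed next states, action) over \<open>n\<close> steps, for the process
  that is in state \<open>s\<close> at step \<open>h\<close>.
\<close>

primrec trajectory ::
  "('s::finite, 'a::finite) lookahead_mdp \<Rightarrow> ('s, 'a) policy \<Rightarrow> nat \<Rightarrow> nat \<Rightarrow> 's
    \<Rightarrow> ('s \<times> ('a \<Rightarrow> 's) \<times> 'a) list pmf" where
  "trajectory M \<pi> 0 h s = return_pmf []"
| "trajectory M \<pi> (Suc n) h s =
    bind_pmf (next_states M h s) (\<lambda>s'.
    bind_pmf (\<pi> h s s') (\<lambda>a.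
    map_pmf (\<lambda>\<tau>. (s, s', a) # \<tau>) (trajectory M \<pi> n (Suc h) (s' a))))"

text \<open>
  Given the states, observations and actions of steps \<open>h..H\<close>, the rewards are independent, the one
  of step \<open>t\<close> following the reward distribution of the state and action of step \<open>t\<close>, which are found
  at position \<open>t - h\<close> of the list.
\<close>

definition rewards_given ::
  "('s::finite, 'a::finite) lookahead_mdp \<Rightarrow> nat \<Rightarrow> ('s \<times> ('a \<Rightarrow> 's) \<times> 'a) list
    \<Rightarrow> (nat \<Rightarrow> real) measure" where
  "rewards_given M h \<tau> =
    PiM {h..horizon M} (\<lambda>t. case \<tau> ! (t - h) of (s, s', a) \<Rightarrow> reward M t s a)"

definition reward_law ::
  "('s::finite, 'a::finite) lookahead_mdp \<Rightarrow> ('s, 'a) policy \<Rightarrow> nat \<Rightarrow> 's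
    \<Rightarrow> (nat \<Rightarrow> real) measure" where
  "reward_law M \<pi> h s =
    measure_pmf (trajectory M \<pi> (Suc (horizon M) - h) h s) \<bind> rewards_given M h"

definition policy_value ::
  "('s::finite, 'a::finite) lookahead_mdp \<Rightarrow> ('s, 'a) policy \<Rightarrow> nat \<Rightarrow> 's \<Rightarrow> real" where
  "policy_value M \<pi> h s = (\<integral>\<rho>. (\<Sum>t\<in>{h..horizon M}. \<rho> t) \<partial>reward_law M \<pi> h s)"

definition optimal_value ::
  "('s::finite, 'a::finite) lookahead_mdp \<Rightarrow> nat \<Rightarrow> 's \<Rightarrow> real" where
  "optimal_value M h s = (SUP \<pi>. policy_value M \<pi> h s)"

definition optimal_policy ::
  "('s::finite, 'a::finite) lookahead_mdp \<Rightarrow> ('s, 'a) policy \<Rightarrow> bool" where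
  "optimal_policy M \<pi> \<longleftrightarrow>
    (\<forall>h\<in>{1..horizon M}. \<forall>s. policy_value M \<pi> h s = optimal_value M h s)"

end

theory Submission imports Defs begin

text \<open>
  Integrating out the rewards turns the value of a policy into the expected sum of mean rewards
  along the trajectory, and peeling off the first step gives the policy evaluation recursion.
  Backward induction on the step then shows that a policy that is greedy for \<open>optimal_value\<close>
  dominates every policy: by the induction hypothesis \<open>optimal_value\<close> at the next step is the value
  of that very policy, and an expectation over actions is at most the maximum over actions, which
  is the expectation over actions of a greedy policy.
\<close>

section \<open>Finite expectations, mean returns and greedy policies\<close>

lemma expectation_bind_pmf_finite:
  fixes g :: "'b \<Rightarrow> real"
  assumes "finite (set_pmf p)" "\<And>x. finite (set_pmf (f x))"
  shows "measure_pmf.expectation (bind_pmf p f) g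
    = measure_pmf.expectation p (\<lambda>x. measure_pmf.expectation (f x) g)"
  using assms by (simp add: pmf_expectation_bind[of "set_pmf p"] integral_measure_pmf[of "set_pmf p"])

lemma finite_set_pmf_trajectory: "finite (set_pmf (trajectory M \<pi> n h s))"
  by (induction n arbitrary: h s) auto

lemma expectation_le_of_set_pmf:
  fixes f :: "'a::finite \<Rightarrow> real"
  assumes "\<And>a. a \<in> set_pmf p \<Longrightarrow> f a \<le> c"
  shows "measure_pmf.expectation p f \<le> c"
proof -
  have "measure_pmf.expectation p f \<le> measure_pmf.expectation p (\<lambda>_. c)"
    by (rule integral_mono_AE) (auto simp: integrable_measure_pmf_finite AE_measure_pmf_iff assms)
  then show ?thesis by simp
qed

lemma expectation_eq_of_set_pmf:
  fixes f :: "'a::finite \<Rightarrow> real"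
  assumes "\<And>a. a \<in> set_pmf p \<Longrightarrow> f a = c"
  shows "measure_pmf.expectation p f = c"
proof -
  have "measure_pmf.expectation p f = measure_pmf.expectation p (\<lambda>_. c)"
    by (rule integral_cong_AE) (auto simp: AE_measure_pmf_iff assms)
  then show ?thesis by simp
qed

text \<open>The conditional expectation of the total reward given the trajectory; the position
  \<open>t - h\<close> mirrors \<open>rewards_given\<close>.\<close>

definition mean_return ::
  "('s::finite, 'a::finite) lookahead_mdp \<Rightarrow> nat \<Rightarrow> ('s \<times> ('a \<Rightarrow> 's) \<times> 'a) list \<Rightarrow> real" where
  "mean_return M h \<tau> =
    (\<Sum>t\<in>{h..horizon M}. case \<tau> ! (t - h) of (s, s', a) \<Rightarrow> mean_reward M t s a)"

text \<open>Dropping the head shifts every later index by one. This holds for lists of any length: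
  past the end, both sides contain the same unspecified \<open>nth\<close> terms.\<close>

lemma mean_return_Cons:
  assumes "h \<le> horizon M"
  shows "mean_return M h ((s, s', a) # \<tau>) = mean_reward M h s a + mean_return M (Suc h) \<tau>"
proof -
  have "((s, s', a) # \<tau>) ! (t - h) = \<tau> ! (t - Suc h)" if "t \<in> {Suc h..horizon M}" for t
    using that by (simp add: nth_Cons')
  then have "(\<Sum>t\<in>{Suc h..horizon M}. case ((s, s', a) # \<tau>) ! (t - h) of (s, s', a) \<Rightarrow> mean_reward M t s a)
      = mean_return M (Suc h) \<tau>"
    unfolding mean_return_def by (intro sum.cong) simp_all
  then show ?thesis
    unfolding mean_return_def using assms by (simp add: sum.atLeast_Suc_atMost)
qed

text \<open>Constraining only the support admits randomised tie-breaking. The reference is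
  \<open>optimal_value\<close>, a supremum over all policies, so the condition is not circular in
  \<open>\<pi>\<close>.\<close>

definition greedy :: "('s::finite, 'a::finite) lookahead_mdp \<Rightarrow> ('s, 'a) policy \<Rightarrow> bool" where
  "greedy M \<pi> \<longleftrightarrow> (\<forall>h\<in>{1..horizon M}. \<forall>s s'.
    set_pmf (\<pi> h s s') \<subseteq>
      {a. is_arg_max (\<lambda>a. mean_reward M h s a + optimal_value M (Suc h) (s' a))
            (\<lambda>a. a \<in> UNIV) a})"

text \<open>A real function on a finite type attains its maximum; choosing a maximiser for each
  step, state and observation gives a deterministic policy.\<close>

lemma greedy_exists:
  fixes M :: "('s::finite, 'a::finite) lookahead_mdp"
  shows "\<exists>\<pi>. greedy M \<pi>"
proof -
  have "\<exists>a. is_arg_max f (\<lambda>a. a \<in> UNIV) a" for f :: "'a \<Rightarrow> real"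
  proof -
    have "Max (range f) \<in> range f"
      by simp
    then obtain a where "f a = Max (range f)"
      by (metis rangeE)
    then show ?thesis
      by (auto simp: is_arg_max_linorder intro!: exI[of _ a])
  qed
  then have "set_pmf (return_pmf (SOME a. is_arg_max f (\<lambda>a. a \<in> UNIV) a))
      \<subseteq> {a. is_arg_max f (\<lambda>a. a \<in> UNIV) a}" for f :: "'a \<Rightarrow> real"
    by (simp del: UNIV_I) (rule someI_ex)
  then show ?thesis
    unfolding greedy_def
    by (intro exI[of _ "\<lambda>h s s'. return_pmf (SOME a.
      is_arg_max (\<lambda>a. mean_reward M h s a + optimal_value M (Suc h) (s' a)) (\<lambda>a. a \<in> UNIV) a)"]) blast
qed

section \<open>Integrating out the rewards\<close>

context
  fixes M :: "('s::finite, 'a::finite) lookahead_mdp"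
  assumes valid: "valid_lookahead_mdp M"
begin

lemma prob_space_reward: "h \<in> {1..horizon M} \<Longrightarrow> prob_space (reward M h s a)"
  and sets_reward: "h \<in> {1..horizon M} \<Longrightarrow> sets (reward M h s a) = sets borel"
  and AE_reward: "h \<in> {1..horizon M} \<Longrightarrow> AE x in reward M h s a. 0 \<le> x \<and> x \<le> 1"
  using valid by (auto simp: valid_lookahead_mdp_def)

context
  fixes h :: nat
  assumes h: "1 \<le> h"
begin

text \<open>The bound \<open>1 \<le> h\<close> puts every step of \<open>{h..horizon M}\<close> in
  the range constrained by \<open>valid_lookahead_mdp\<close>. The case
  \<open>h > horizon M\<close>, an empty product, stays covered and serves the terminal
  step.\<close>

lemma prob_space_component:
  "t \<in> {h..horizon M} \<Longrightarrow>
    prob_space (case \<tau> ! (t - h) of (s, s', a) \<Rightarrow> reward M t s a)"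
  using prob_space_reward[of t] h by (auto split: prod.split)

lemma prob_space_rewards_given: "prob_space (rewards_given M h \<tau>)"
  unfolding rewards_given_def by (intro prob_space_PiM prob_space_component)

lemma sets_rewards_given: "sets (rewards_given M h \<tau>) = sets (PiM {h..horizon M} (\<lambda>_. borel))"
  unfolding rewards_given_def using sets_reward h
  by (intro sets_PiM_cong) (auto split: prod.split)

text \<open>The source is discrete, so it suffices that every value is a subprobability measure on
  one common sigma-algebra.\<close>

lemma rewards_given_measurable:
  "rewards_given M h \<in> measurable (measure_pmf p) (subprob_algebra (PiM {h..horizon M} (\<lambda>_. borel)))"
  by (simp add: space_subprob_algebra sets_rewards_given
      prob_space_rewards_given prob_space_imp_subprob_space)

lemma AE_rewards_given:
  "AE \<rho> in rewards_given M h \<tau>. \<forall>t\<in>{h..horizon M}. 0 \<le> \<rho> t \<and> \<rho> t \<le> 1"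
proof (subst AE_finite_all, simp, intro ballI)
  fix t assume t: "t \<in> {h..horizon M}"
  show "AE \<rho> in rewards_given M h \<tau>. 0 \<le> \<rho> t \<and> \<rho> t \<le> 1"
    unfolding rewards_given_def
  proof (rule AE_PiM_component[where P="\<lambda>x. 0 \<le> x \<and> x \<le> 1", OF prob_space_component t])
    show "AE x in case \<tau> ! (t - h) of (s, s', a) \<Rightarrow> reward M t s a. 0 \<le> x \<and> x \<le> 1"
      using AE_reward[of t] t h by (simp split: prod.split)
  qed
qed

lemma component_measurable [measurable]:
  "t \<in> {h..horizon M} \<Longrightarrow> (\<lambda>\<rho>. \<rho> t) \<in> borel_measurable (rewards_given M h \<tau>)"
  by (subst measurable_cong_sets[OF sets_rewards_given refl]) simp

lemma integrable_component:
  assumes t: "t \<in> {h..horizon M}"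
  shows "integrable (rewards_given M h \<tau>) (\<lambda>\<rho>. \<rho> t)"
proof -
  interpret prob_space "rewards_given M h \<tau>" by (rule prob_space_rewards_given)
  have "AE \<rho> in rewards_given M h \<tau>. norm (\<rho> t) \<le> 1"
    using AE_rewards_given by eventually_elim (use t in auto)
  then show ?thesis
    using t by (intro integrable_const_bound) auto
qed

text \<open>The marginal of a product of probability measures at \<open>t\<close> is its factor at
  \<open>t\<close>; change of variables along the projection yields the mean.\<close>

lemma integral_component:
  assumes t: "t \<in> {h..horizon M}"
  shows "(\<integral>\<rho>. \<rho> t \<partial>rewards_given M h \<tau>) = (case \<tau> ! (t - h) of (s, s', a) \<Rightarrow> mean_reward M t s a)"
proof -
  let ?R = "\<lambda>t. case \<tau> ! (t - h) of (s, s', a) \<Rightarrow> reward M t s a"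
  have "(\<integral>x. x \<partial>?R t) = (\<integral>x. x \<partial>distr (PiM {h..horizon M} ?R) (?R t) (\<lambda>\<rho>. \<rho> t))"
    by (subst distr_PiM_component[OF prob_space_component t]) auto
  also have "\<dots> = (\<integral>\<rho>. \<rho> t \<partial>PiM {h..horizon M} ?R)"
  proof (rule integral_distr)
    show "(\<lambda>\<rho>. \<rho> t) \<in> measurable (PiM {h..horizon M} ?R) (?R t)"
      using t by simp
    have "sets (?R t) = sets borel"
      using sets_reward[of t] t h by (auto split: prod.split)
    then show "(\<lambda>x. x) \<in> borel_measurable (?R t)"
      by (simp cong: measurable_cong_sets)
  qed
  finally show ?thesis
    by (simp add: rewards_given_def mean_reward_def split: prod.split_asm prod.split)
qed

text \<open>Tower property: conditioning on the trajectory leaves an inner integral over the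
  rewards, which is evaluated by linearity.\<close>

lemma policy_value_eq:
  "policy_value M \<pi> h s =
    measure_pmf.expectation (trajectory M \<pi> (Suc (horizon M) - h) h s) (mean_return M h)"
proof -
  let ?p = "trajectory M \<pi> (Suc (horizon M) - h) h s" and ?I = "{h..horizon M}"
  let ?K = "PiM ?I (\<lambda>_. borel) :: (nat \<Rightarrow> real) measure"
  let ?f = "\<lambda>\<rho>. \<Sum>t\<in>?I. \<rho> t" and ?g = "\<lambda>\<rho>. \<Sum>t\<in>?I. max 0 (min 1 (\<rho> t))"
  \<comment> \<open>\<open>integral_bind\<close> needs a bounded integrand, hence the truncation of the rewards.\<close>
  have fg: "AE \<rho> in rewards_given M h \<tau>. ?f \<rho> = ?g \<rho>" for \<tau>
    using AE_rewards_given by eventually_elim (auto intro!: sum.cong)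
  have meas: "?f \<in> borel_measurable ?K" "?g \<in> borel_measurable ?K"
    by measurable
  have sets: "sets (reward_law M \<pi> h s) = sets ?K"
    unfolding reward_law_def by (rule sets_bind) (auto simp: sets_rewards_given)
  have "policy_value M \<pi> h s = (\<integral>\<rho>. ?g \<rho> \<partial>reward_law M \<pi> h s)"
    unfolding policy_value_def
  proof (rule integral_cong_AE)
    show "AE \<rho> in reward_law M \<pi> h s. ?f \<rho> = ?g \<rho>"
      unfolding reward_law_def
    proof (subst AE_bind[OF rewards_given_measurable])
      show "Measurable.pred ?K (\<lambda>\<rho>. ?f \<rho> = ?g \<rho>)"
        using borel_measurable_eq[OF meas] by (simp add: pred_def)
    qed (simp add: fg)
  qed (simp_all only: measurable_cong_sets[OF sets refl] meas)
  also have "\<dots> = (\<integral>\<tau>. \<integral>\<rho>. ?g \<rho> \<partial>rewards_given M h \<tau> \<partial>?p)"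
    unfolding reward_law_def
  proof (rule integral_bind[OF meas(2) _ rewards_given_measurable])
    fix \<rho> :: "nat \<Rightarrow> real"
    show "\<bar>?g \<rho>\<bar> \<le> real (card ?I)"
      using sum_bounded_above[of ?I "\<lambda>t. max 0 (min 1 (\<rho> t))" 1]
      by (simp add: sum_nonneg)
    show "AE \<tau> in ?p. emeasure (rewards_given M h \<tau>) (space (rewards_given M h \<tau>)) \<le> ennreal 1"
      by (simp add: prob_space.emeasure_space_1[OF prob_space_rewards_given])
  qed (rule measure_pmf.finite_measure)
  also have "\<dots> = (\<integral>\<tau>. mean_return M h \<tau> \<partial>?p)"
  proof (rule Bochner_Integration.integral_cong[OF refl])
    fix \<tau>
    \<comment> \<open>The truncation, almost surely invisible, is removed again so that linearity
      and \<open>integral_component\<close> apply.\<close>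
    have "(\<integral>\<rho>. ?g \<rho> \<partial>rewards_given M h \<tau>) = (\<integral>\<rho>. ?f \<rho> \<partial>rewards_given M h \<tau>)"
      using fg[of \<tau>] meas measurable_cong_sets[OF sets_rewards_given[of \<tau>] refl]
      by (intro integral_cong_AE) auto
    also have "\<dots> = mean_return M h \<tau>"
      by (simp add: mean_return_def integrable_component integral_component)
    finally show "(\<integral>\<rho>. ?g \<rho> \<partial>rewards_given M h \<tau>) = mean_return M h \<tau>" .
  qed
  finally show ?thesis .
qed

end

section \<open>Policy evaluation and dominance of greedy policies\<close>

lemma policy_value_Suc_horizon: "policy_value M \<pi> (Suc (horizon M)) s = 0"
  by (simp add: policy_value_eq mean_return_def)

text \<open>After its first triple the trajectory is that of the process in state
  \<open>s' a\<close> at step \<open>Suc h\<close>, so the expected tail of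
  \<open>mean_return\<close> is again a policy value.\<close>

lemma policy_value_step:
  assumes h: "h \<in> {1..horizon M}"
  shows "policy_value M \<pi> h s =
    measure_pmf.expectation (next_states M h s) (\<lambda>s'.
      measure_pmf.expectation (\<pi> h s s') (\<lambda>a.
        mean_reward M h s a + policy_value M \<pi> (Suc h) (s' a)))"
proof -
  \<comment> \<open>Exposes a successor for the recursion of \<open>trajectory\<close>, leaving the
    length in the form it has in the value at \<open>Suc h\<close>.\<close>
  have n: "Suc (horizon M) - h = Suc (Suc (horizon M) - Suc h)"
    using h by auto
  have "policy_value M \<pi> (Suc h) s =
      measure_pmf.expectation (trajectory M \<pi> (Suc (horizon M) - Suc h) (Suc h) s)
        (mean_return M (Suc h))" for s
    by (simp add: policy_value_eq)
  moreover have "policy_value M \<pi> h s =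
      measure_pmf.expectation (trajectory M \<pi> (Suc (horizon M) - h) h s) (mean_return M h)"
    using h by (simp add: policy_value_eq)
  ultimately show ?thesis
    unfolding n trajectory.simps using h
    by (simp add: expectation_bind_pmf_finite finite_set_pmf_trajectory mean_return_Cons
        integrable_measure_pmf_finite del: diff_Suc_Suc)
qed

text \<open>The integrand is constant on the support, since every action there attains the
  maximum.\<close>

lemma greedy_expectation:
  assumes "greedy M \<pi>" "h \<in> {1..horizon M}"
  shows "measure_pmf.expectation (\<pi> h s s')
      (\<lambda>a. mean_reward M h s a + optimal_value M (Suc h) (s' a))
    = (MAX a\<in>UNIV. mean_reward M h s a + optimal_value M (Suc h) (s' a))"
proof (rule expectation_eq_of_set_pmf)
  fix a assume "a \<in> set_pmf (\<pi> h s s')"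
  then have "is_arg_max (\<lambda>a. mean_reward M h s a + optimal_value M (Suc h) (s' a)) (\<lambda>a. a \<in> UNIV) a"
    using assms unfolding greedy_def by blast
  then show "mean_reward M h s a + optimal_value M (Suc h) (s' a)
    = (MAX a\<in>UNIV. mean_reward M h s a + optimal_value M (Suc h) (s' a))"
    by (intro Max_eqI[symmetric]) (auto simp: is_arg_max_linorder)
qed

text \<open>An attained upper bound is the supremum, so boundedness of the set of values comes with
  it.\<close>

lemma optimal_value_eqI:
  assumes "\<And>\<pi>'. policy_value M \<pi>' h s \<le> policy_value M \<pi> h s"
  shows "optimal_value M h s = policy_value M \<pi> h s"
  unfolding optimal_value_def using assms by (intro cSup_eq_maximum) auto

lemma greedy_dominates:
  assumes greedy: "greedy M \<pi>" and "1 \<le> h" "h \<le> Suc (horizon M)"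
  shows "policy_value M \<pi>' h s \<le> policy_value M \<pi> h s"
  using assms(3)
\<comment> \<open>Successor states vary, and \<open>opt\<close> below needs the hypothesis against
  all rival policies, hence the generalisation over \<open>s\<close> and
  \<open>\<pi>'\<close>.\<close>
proof (induction h arbitrary: s \<pi>' rule: inc_induct)
  case base
  then show ?case by (simp add: policy_value_Suc_horizon)
next
  case (step n)
  have n: "n \<in> {1..horizon M}"
    using step.hyps \<open>1 \<le> h\<close> by simp
  have opt: "optimal_value M (Suc n) s = policy_value M \<pi> (Suc n) s" for s
    by (rule optimal_value_eqI) (rule step.IH)
  let ?q = "\<lambda>s' a. mean_reward M n s a + optimal_value M (Suc n) (s' a)"
  have "measure_pmf.expectation (\<pi>' n s s') (\<lambda>a. mean_reward M n s a + policy_value M \<pi>' (Suc n) (s' a))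
      \<le> (MAX a\<in>UNIV. ?q s' a)" for s'
  proof (rule expectation_le_of_set_pmf)
    fix a
    have "mean_reward M n s a + policy_value M \<pi>' (Suc n) (s' a) \<le> ?q s' a"
      by (simp add: opt step.IH)
    also have "\<dots> \<le> (MAX a\<in>UNIV. ?q s' a)"
      by simp
    finally show "mean_reward M n s a + policy_value M \<pi>' (Suc n) (s' a) \<le> (MAX a\<in>UNIV. ?q s' a)" .
  qed
  then have "policy_value M \<pi>' n s \<le> measure_pmf.expectation (next_states M n s)
      (\<lambda>s'. MAX a\<in>UNIV. ?q s' a)"
    unfolding policy_value_step[OF n]
    by (intro integral_mono integrable_measure_pmf_finite) auto
  also have "\<dots> = policy_value M \<pi> n s"
    \<comment> \<open>Reading \<open>opt\<close> from right to left turns the continuation value of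
      \<open>\<pi>\<close> into \<open>optimal_value\<close>, for which \<open>\<pi>\<close> is
      greedy.\<close>
    unfolding policy_value_step[OF n] by (simp add: greedy_expectation[OF greedy n] flip: opt)
  finally show ?case .
qed

lemma optimal_value_greedy:
  assumes "greedy M \<pi>" "1 \<le> h" "h \<le> Suc (horizon M)"
  shows "optimal_value M h s = policy_value M \<pi> h s"
  using assms by (intro optimal_value_eqI greedy_dominates)

end

theorem proposition2:
  fixes M :: "('s::finite, 'a::finite) lookahead_mdp"
  assumes "valid_lookahead_mdp M"
  shows "(\<forall>s. optimal_value M (Suc (horizon M)) s = 0) \<and>
    (\<forall>h\<in>{1..horizon M}. \<forall>s.
      optimal_value M h s =
        measure_pmf.expectation (next_states M h s)
          (\<lambda>s'. MAX a\<in>UNIV. mean_reward M h s a + optimal_value M (Suc h) (s' a))) \<and>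
    (\<exists>\<pi>. optimal_policy M \<pi>) \<and>
    (\<forall>\<pi> :: ('s, 'a) policy.
      (\<forall>h\<in>{1..horizon M}. \<forall>s s'.
        set_pmf (\<pi> h s s') \<subseteq>
          {a. is_arg_max (\<lambda>a. mean_reward M h s a + optimal_value M (Suc h) (s' a))
                (\<lambda>a. a \<in> UNIV) a})
      \<longrightarrow> optimal_policy M \<pi>)"
proof -
  obtain \<pi>g where g: "greedy M \<pi>g"
    using greedy_exists by blast
  have bellman: "optimal_value M h s = measure_pmf.expectation (next_states M h s)
      (\<lambda>s'. MAX a\<in>UNIV. mean_reward M h s a + optimal_value M (Suc h) (s' a))"
    if h: "h \<in> {1..horizon M}" for h s
    \<comment> \<open>Writing the maximum as an expectation under \<open>\<pi>g\<close> reduces the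
      Bellman equation to policy evaluation for \<open>\<pi>g\<close>, whose values are optimal at
      \<open>h\<close> and \<open>Suc h\<close>.\<close>
    unfolding greedy_expectation[OF assms g h, symmetric]
    using h by (simp add: optimal_value_greedy[OF assms g] policy_value_step[OF assms h])
  have opt: "optimal_policy M \<pi>" if "greedy M \<pi>" for \<pi>
    using optimal_value_greedy[OF assms that] by (simp add: optimal_policy_def)
  have "optimal_value M (Suc (horizon M)) s = 0" for s
    by (simp add: optimal_value_greedy[OF assms g] policy_value_Suc_horizon[OF assms])
  then show ?thesis
    using bellman opt g unfolding greedy_def by (intro conjI allI ballI impI) blast+
qed

end
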